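(* For all real $p, a$ with $1\leq p<\infty$ and $a<p-1$, $$C_{p,a}^p=\sup\Bigl\{k_{p,a}(\alpha,\beta):\ \alpha<\frac{p-1-a}{p}<\beta\Bigr\},$$ where the supremum is over real $\alpha,\beta$.
   Context: For a locally integrable $f\colon[0,\infty)\to\mathbb{R}$ the Hardy operator is $Hf(t)=\frac1t\int_0^t f(s)\,ds$, $t>0$. For $1\le p<\infty$ and $a<p-1$, $C_{p,a}$ denotes the smallest constant $K$ such that $$\int_0^\infty|Hf(t)-f(t)|^p t^a\,dt\le K^p\int_0^\infty|f(t)|^pt^a\,dt$$ for all (measurable) $f\colon[0,\infty)\to\mathbb{R}$ for which the right-hand side is finite (such $f$ are automatically locally integrable on $[0,\infty)$). For $\alpha<\frac{p-1-a}{p}<\beta$, $$k_{p,a}(\alpha,\beta)=\frac{(\beta-\frac{p-1-a}{p})|\alpha-1|^p+(\frac{p-1-a}{p}-\alpha)|\beta-1|^p}{(\beta-\frac{p-1-a}{p})|\alpha|^p+(\frac{p-1-a}{p}-\alpha)|\beta|^p}.$$ *)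

theory Defs
  imports "HOL-Analysis.Analysis"
begin

definition hardy :: "(real \<Rightarrow> real) \<Rightarrow> real \<Rightarrow> real" where
  "hardy f t = (1 / t) * (LINT s:{0..t}|lebesgue. f s)"

text \<open>Functions on $[0,\infty)$ are total functions of which only the restriction to
  \<open>{0..}\<close> matters. The integrals take values in \<open>ennreal\<close>, so that the left-hand
  one is meaningful before it is known to be finite.\<close>

definition hardy_minus_id_bound :: "real \<Rightarrow> real \<Rightarrow> real \<Rightarrow> bool" where
  "hardy_minus_id_bound p a K \<longleftrightarrow> 0 \<le> K \<and>
    (\<forall>f \<in> borel_measurable (lebesgue_on {0..}).
       (\<integral>\<^sup>+t\<in>{0<..}. ennreal (\<bar>f t\<bar> powr p * t powr a) \<partial>lebesgue) < \<infinity> \<longrightarrow>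
       (\<integral>\<^sup>+t\<in>{0<..}. ennreal (\<bar>hardy f t - f t\<bar> powr p * t powr a) \<partial>lebesgue)
         \<le> ennreal (K powr p) * (\<integral>\<^sup>+t\<in>{0<..}. ennreal (\<bar>f t\<bar> powr p * t powr a) \<partial>lebesgue))"

definition hardy_const :: "real \<Rightarrow> real \<Rightarrow> real" where
  "hardy_const p a = (LEAST K. hardy_minus_id_bound p a K)"

definition kfun :: "real \<Rightarrow> real \<Rightarrow> real \<Rightarrow> real \<Rightarrow> real" where
  "kfun p a \<alpha> \<beta> =
     ((\<beta> - (p - 1 - a) / p) * \<bar>\<alpha> - 1\<bar> powr p + ((p - 1 - a) / p - \<alpha>) * \<bar>\<beta> - 1\<bar> powr p) /
     ((\<beta> - (p - 1 - a) / p) * \<bar>\<alpha>\<bar> powr p + ((p - 1 - a) / p - \<alpha>) * \<bar>\<beta>\<bar> powr p)"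

definition kvalues :: "real \<Rightarrow> real \<Rightarrow> real set" where
  "kvalues p a = {kfun p a \<alpha> \<beta> | \<alpha> \<beta>. \<alpha> < (p - 1 - a) / p \<and> (p - 1 - a) / p < \<beta>}"

end

theory Submission imports Defs begin

text \<open>Put \<open>g = (p - 1 - a) / p\<close>, \<open>F t = \<integral>\<^sub>0\<^sup>t f\<close> and \<open>w t = t powr (- g) * F t\<close>. In terms of
  \<open>x = t powr (1 - g) * f t = g * w + t * w'\<close> the two integrands are \<open>\<bar>w - x\<bar> powr p / t\<close> and
  \<open>\<bar>x\<bar> powr p / t\<close>. That \<open>C\<close> bounds all values \<open>k(\<alpha>, \<beta>)\<close> means that some line through \<open>(g, 0)\<close>
  lies above \<open>\<lambda>x. \<bar>x - 1\<bar> powr p - C * \<bar>x\<bar> powr p\<close>. If \<open>m\<close> is the negative of its slope, homogeneity gives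
  \<open>\<bar>w - x\<bar> powr p - C * \<bar>x\<bar> powr p \<le> m * (g * w - x) * sgn w * \<bar>w\<bar> powr (p - 1)\<close>, and the right-hand side
  divided by \<open>t\<close> is the derivative of \<open>- (m / p) * \<bar>w\<bar> powr p\<close>. This integrates to \<open>0\<close>
  because \<open>w\<close> vanishes at \<open>0\<close> and at \<open>\<infinity>\<close>. Conversely, functions equal to
  \<open>\<beta> * t powr (\<beta> - 1)\<close> on \<open>(0, 1]\<close> and to \<open>\<alpha> * t powr (\<alpha> - 1)\<close> afterwards attain the ratio
  \<open>k(\<alpha>, \<beta>)\<close>.\<close>

subsection \<open>Absolutely continuous functions\<close>

text \<open>For \<open>A \<le> B\<close> this is absolute continuity of \<open>F\<close> with
  \<open>F' = f\<close> almost everywhere. Encoding it through increments means that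
  \<open>F\<close> never has to be differentiated at a point.\<close>

definition ac_primitive :: "real \<Rightarrow> real \<Rightarrow> (real \<Rightarrow> real) \<Rightarrow> (real \<Rightarrow> real) \<Rightarrow> bool" where
  "ac_primitive A B f F \<longleftrightarrow> f absolutely_integrable_on {A..B} \<and>
     (\<forall>x y. A \<le> x \<longrightarrow> x \<le> y \<longrightarrow> y \<le> B \<longrightarrow> (f has_integral (F y - F x)) {x..y})"

lemma ac_primitiveD:
  assumes "ac_primitive A B f F"
  shows "f absolutely_integrable_on {A..B}"
    and "A \<le> x \<Longrightarrow> x \<le> y \<Longrightarrow> y \<le> B \<Longrightarrow> (f has_integral (F y - F x)) {x..y}"
  using assms unfolding ac_primitive_def by auto

lemma ac_primitiveI:
  assumes f: "f absolutely_integrable_on {A..B}"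
    and F: "\<And>x. A \<le> x \<Longrightarrow> x \<le> B \<Longrightarrow> F x = F A + integral {A..x} f"
  shows "ac_primitive A B f F"
  unfolding ac_primitive_def
proof (intro conjI allI impI f)
  fix x y assume xy: "A \<le> x" "x \<le> y" "y \<le> B"
  have i: "f integrable_on {A..B}"
    using f by (rule set_lebesgue_integral_eq_integral)
  have iy: "f integrable_on {A..y}" "f integrable_on {x..y}"
    using integrable_on_subinterval[OF i] xy by auto
  have "integral {A..x} f + integral {x..y} f = integral {A..y} f"
    using Henstock_Kurzweil_Integration.integral_combine[OF _ _ iy(1)] xy by auto
  then have "integral {x..y} f = F y - F x" using F[of x] F[of y] xy by auto
  then show "(f has_integral (F y - F x)) {x..y}"
    using integrable_integral[OF iy(2)] by simp
qed

lemma ac_primitive_continuous_on: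
  assumes "ac_primitive A B f F"
  shows "continuous_on {A..B} F"
proof (cases "A \<le> B")
  case True
  have "continuous_on {A..B} (\<lambda>x. F A + integral {A..x} f)"
    by (intro continuous_intros indefinite_integral_continuous_1
        set_lebesgue_integral_eq_integral(1) ac_primitiveD[OF assms])
  moreover have "F x = F A + integral {A..x} f" if "x \<in> {A..B}" for x
    using ac_primitiveD(2)[OF assms, of A x] that by (auto dest: integral_unique)
  ultimately show ?thesis using continuous_on_cong by (metis (mono_tags, lifting))
qed auto

lemma absolutely_integrable_continuous_mult:
  fixes f g :: "real \<Rightarrow> real"
  assumes "continuous_on {A..B} g" "f absolutely_integrable_on {A..B}"
  shows "(\<lambda>x. g x * f x) absolutely_integrable_on {A..B}"
  using assms
  by (intro absolutely_integrable_bounded_measurable_product_real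
      continuous_imp_measurable_on_sets_lebesgue compact_imp_bounded compact_continuous_image) auto

text \<open>By the mean value theorem the difference of the two sides changes by at most
  \<open>\<epsilon> * \<integral>\<bar>f\<bar>\<close> over any sufficiently short interval, so Bolzano's subdivision
  principle makes it at most \<open>\<epsilon> * \<integral>\<bar>f\<bar>\<close> over the whole interval.\<close>

lemma ac_primitive_compose:
  assumes F: "ac_primitive A B f F"
    and d: "\<And>y. (\<Phi> has_real_derivative \<phi> y) (at y)" and c: "continuous_on UNIV \<phi>"
  shows "ac_primitive A B (\<lambda>t. \<phi> (F t) * f t) (\<lambda>t. \<Phi> (F t))"
proof (rule ac_primitiveI)
  let ?g = "\<lambda>t. \<phi> (F t) * f t"
  note Fc = ac_primitive_continuous_on[OF F]
  have pc: "continuous_on {A..B} (\<lambda>t. \<phi> (F t))"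
    using continuous_on_compose2[OF c Fc] by auto
  show g: "?g absolutely_integrable_on {A..B}"
    by (intro absolutely_integrable_continuous_mult pc ac_primitiveD(1)[OF F])
  have fi: "(\<lambda>t. \<bar>f t\<bar>) integrable_on {x..y}" "f integrable_on {x..y}" "?g integrable_on {x..y}"
    if "A \<le> x" "y \<le> B" for x y
  proof -
    have s: "{x..y} \<subseteq> {A..B}" using that by auto
    show "(\<lambda>t. \<bar>f t\<bar>) integrable_on {x..y}" "f integrable_on {x..y}"
      using absolutely_integrable_on_subinterval[OF ac_primitiveD(1)[OF F] s]
      by (auto simp: absolutely_integrable_on_def)
    show "?g integrable_on {x..y}"
      using absolutely_integrable_on_subinterval[OF g s] by (auto simp: absolutely_integrable_on_def)
  qed
  fix b assume b: "A \<le> b" "b \<le> B"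
  define D where "D u v = \<bar>\<Phi> (F v) - \<Phi> (F u) - integral {u..v} ?g\<bar>" for u v
  define V where "V u v = integral {u..v} (\<lambda>t. \<bar>f t\<bar>)" for u v
  have V0: "0 \<le> V A b" unfolding V_def by (rule integral_nonneg[OF fi(1)]) (use b in auto)
  have key: "D A b \<le> e * V A b" if e: "e > 0" for e
  proof -
    let ?P = "\<lambda>u v. A \<le> u \<and> v \<le> b \<and> u \<le> v \<longrightarrow> D u v \<le> e * V u v"
    have "?P A b"
    proof (rule Bolzano[where P = ?P, OF b(1)])
      fix u v w assume 1: "?P u v" "?P v w" "u \<le> v" "v \<le> w"
      show "?P u w"
      proof
        assume uw: "A \<le> u \<and> w \<le> b \<and> u \<le> w"
        have V: "V u v + V v w = V u w" unfolding V_def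
          by (rule Henstock_Kurzweil_Integration.integral_combine) (use fi(1) uw b 1 in auto)
        have "integral {u..v} ?g + integral {v..w} ?g = integral {u..w} ?g"
          by (rule Henstock_Kurzweil_Integration.integral_combine) (use fi(3) uw b 1 in auto)
        then have "D u w \<le> D u v + D v w" unfolding D_def by linarith
        also have "\<dots> \<le> e * V u v + e * V v w"
          by (rule add_mono) (use 1 uw in auto)
        finally show "D u w \<le> e * V u w" using V by (metis distrib_left)
      qed
    next
      fix x assume x: "A \<le> x" "x \<le> b"
      have xB: "x \<in> {A..B}" using x b by auto
      have "isCont \<phi> (F x)" using c by (simp add: continuous_on_eq_continuous_at)
      then obtain r where r: "r > 0" "\<And>y. \<bar>y - F x\<bar> < r \<Longrightarrow> \<bar>\<phi> y - \<phi> (F x)\<bar> < e/2"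
        unfolding continuous_at_eps_delta dist_real_def using e by (metis half_gt_zero)
      obtain s where s: "s > 0" "\<And>t. t \<in> {A..B} \<Longrightarrow> \<bar>t - x\<bar> < s \<Longrightarrow> \<bar>F t - F x\<bar> < r"
        using Fc xB r(1) unfolding continuous_on_iff dist_real_def by metis
      show "\<exists>d>0. \<forall>u v. u \<le> x \<and> x \<le> v \<and> v - u < d \<longrightarrow> ?P u v"
      proof (intro exI[of _ s] conjI s(1) allI impI)
        fix u v assume uv: "u \<le> x \<and> x \<le> v \<and> v - u < s" and AB: "A \<le> u \<and> v \<le> b \<and> u \<le> v"
        have near: "\<bar>F t - F x\<bar> < r" if "t \<in> {u..v}" for t
          using s(2)[of t] that uv AB b by auto
        \<comment> \<open>The mean value theorem is applied between the values \<open>F u\<close>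
          and \<open>F v\<close>, which may come in either order; if they coincide, any point near
          \<open>F x\<close> serves.\<close>
        obtain z where z: "\<bar>z - F x\<bar> < r" "\<Phi> (F v) - \<Phi> (F u) = \<phi> z * (F v - F u)"
        proof (cases "F u = F v")
          case True then show ?thesis using that[of "F x"] r by auto
        next
          case False
          have "\<exists>z. min (F u) (F v) < z \<and> z < max (F u) (F v) \<and>
              \<Phi> (max (F u) (F v)) - \<Phi> (min (F u) (F v)) = (max (F u) (F v) - min (F u) (F v)) * \<phi> z"
            by (rule MVT2) (use False d in auto)
          then obtain z where z: "min (F u) (F v) < z" "z < max (F u) (F v)"
              "\<Phi> (max (F u) (F v)) - \<Phi> (min (F u) (F v)) = (max (F u) (F v) - min (F u) (F v)) * \<phi> z"
            by auto
          show ?thesis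
          proof (rule that)
            show "\<bar>z - F x\<bar> < r" using near[of u] near[of v] z(1,2) AB by (auto simp: min_def max_def split: if_splits)
            show "\<Phi> (F v) - \<Phi> (F u) = \<phi> z * (F v - F u)"
              using z(3) by (auto simp: min_def max_def algebra_simps split: if_splits)
          qed
        qed
        \<comment> \<open>As \<open>f\<close> integrates to \<open>F v - F u\<close>, the error over
          \<open>{u..v}\<close> is the integral of \<open>(\<phi> z - \<phi> (F t)) * f t\<close>.
          Both \<open>z\<close> and \<open>F t\<close> lie within \<open>r\<close> of
          \<open>F x\<close>, so two deviations below \<open>e/2\<close> give the factor
          \<open>e\<close>.\<close>
        have "(f has_integral (F v - F u)) {u..v}" by (rule ac_primitiveD(2)[OF F]) (use AB b in auto)
        then have "((\<lambda>t. \<phi> z * f t) has_integral \<phi> z * (F v - F u)) {u..v}"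
          by (rule has_integral_mult_right)
        then have "((\<lambda>t. \<phi> z * f t - ?g t) has_integral (\<phi> z * (F v - F u) - integral {u..v} ?g)) {u..v}"
          by (intro has_integral_diff integrable_integral fi) (use AB b in auto)
        then have i: "(\<lambda>t. \<phi> z * f t - ?g t) integrable_on {u..v}"
            "integral {u..v} (\<lambda>t. \<phi> z * f t - ?g t) = \<phi> z * (F v - F u) - integral {u..v} ?g"
          by (auto dest: integral_unique)
        have "D u v = norm (integral {u..v} (\<lambda>t. \<phi> z * f t - ?g t))"
          unfolding D_def z(2) i(2) by simp
        also have "\<dots> \<le> integral {u..v} (\<lambda>t. e * \<bar>f t\<bar>)"
        proof (rule integral_norm_bound_integral[OF i(1)])
          show "(\<lambda>t. e * \<bar>f t\<bar>) integrable_on {u..v}"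
            by (intro integrable_on_mult_right fi) (use AB b in auto)
          fix t assume t: "t \<in> {u..v}"
          have "\<bar>\<phi> z - \<phi> (F t)\<bar> \<le> e" using r(2)[OF z(1)] r(2)[OF near[OF t]] by linarith
          then have "\<bar>\<phi> z - \<phi> (F t)\<bar> * \<bar>f t\<bar> \<le> e * \<bar>f t\<bar>" by (rule mult_right_mono) auto
          then show "norm (\<phi> z * f t - ?g t) \<le> e * \<bar>f t\<bar>"
            by (simp add: abs_mult[symmetric] left_diff_distrib)
        qed
        also have "\<dots> = e * V u v" unfolding V_def by simp
        finally show "D u v \<le> e * V u v" .
      qed
    qed
    then show ?thesis using b by auto
  qed
  have "D A b \<le> 0"
  proof (rule field_le_epsilon)
    fix e :: real assume e: "0 < e"
    \<comment> \<open>The added 1 keeps the denominator positive when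
      \<open>V A b = 0\<close>.\<close>
    have "D A b \<le> e / (V A b + 1) * V A b" by (rule key) (use e V0 in auto)
    also have "\<dots> \<le> 0 + e" using e V0 by (simp add: field_simps)
    finally show "D A b \<le> 0 + e" .
  qed
  then show "\<Phi> (F b) = \<Phi> (F A) + integral {A..b} ?g" unfolding D_def by auto
qed

lemma ac_primitive_add:
  assumes "ac_primitive A B f F" "ac_primitive A B g G"
  shows "ac_primitive A B (\<lambda>t. f t + g t) (\<lambda>t. F t + G t)"
  using assms unfolding ac_primitive_def
  by (auto intro!: set_integral_add simp: add_diff_add intro!: has_integral_add)

lemma ac_primitive_cmult:
  assumes "ac_primitive A B f F"
  shows "ac_primitive A B (\<lambda>t. c * f t) (\<lambda>t. c * F t)"
  using assms unfolding ac_primitive_def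
  by (auto simp: right_diff_distrib[symmetric] intro!: has_integral_mult_right)

text \<open>Polarisation: \<open>F * G\<close> is half of \<open>(F + G)^2 - F^2 - G^2\<close>, so
  the product rule follows from the chain rule for squaring.\<close>

lemma ac_primitive_mult:
  assumes F: "ac_primitive A B f F" and G: "ac_primitive A B g G"
  shows "ac_primitive A B (\<lambda>t. f t * G t + F t * g t) (\<lambda>t. F t * G t)"
proof -
  have sq: "ac_primitive A B (\<lambda>t. (2 * H t) * h t) (\<lambda>t. (H t)\<^sup>2)" if "ac_primitive A B h H" for h H
    by (rule ac_primitive_compose[OF that]) (auto intro!: derivative_eq_intros continuous_intros)
  have "ac_primitive A B
     (\<lambda>t. 1/2 * (2 * (F t + G t) * (f t + g t)) + (- 1/2 * (2 * F t * f t) + - 1/2 * (2 * G t * g t)))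
     (\<lambda>t. 1/2 * (F t + G t)\<^sup>2 + (- 1/2 * (F t)\<^sup>2 + - 1/2 * (G t)\<^sup>2))"
    by (intro ac_primitive_add ac_primitive_cmult sq F G)
  then show ?thesis
    by (simp add: algebra_simps power2_eq_square) 
qed

lemma ac_primitive_C1:
  assumes "\<And>t. t \<in> {A..B} \<Longrightarrow> (G has_real_derivative g t) (at t)" "continuous_on {A..B} g"
  shows "ac_primitive A B g G"
  unfolding ac_primitive_def
proof (intro conjI allI impI)
  show "g absolutely_integrable_on {A..B}" by (rule absolutely_integrable_continuous_real) fact
  fix x y assume "A \<le> x" "x \<le> y" "y \<le> B"
  then show "(g has_integral G y - G x) {x..y}"
    by (intro fundamental_theorem_of_calculus)
      (auto simp: has_real_derivative_iff_has_vector_derivative[symmetric]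
        intro!: has_field_derivative_at_within assms)
qed

section \<open>The chain rule for powers of the absolute value\<close>

lemma DERIV_abs_powr:
  fixes q x :: real
  assumes q: "1 < q"
  shows "((\<lambda>y. \<bar>y\<bar> powr q / q) has_real_derivative sgn x * \<bar>x\<bar> powr (q - 1)) (at x)"
proof (cases "x = 0")
  case False
  have "((\<lambda>y. (sgn x * y) powr q / q) has_real_derivative sgn x * \<bar>x\<bar> powr (q - 1)) (at x)"
    using False q by (auto intro!: derivative_eq_intros simp: sgn_if abs_if)
  \<comment> \<open>Away from 0 the sign is locally constant, so the absolute value is locally the
    linear map \<open>sgn x * y\<close>.\<close>
  moreover have "\<forall>\<^sub>F y in nhds x. \<bar>y\<bar> powr q / q = (sgn x * y) powr q / q"
  proof (cases "x > 0")
    case True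
    then have "\<forall>\<^sub>F y in nhds x. y \<in> {0<..}" by (intro eventually_nhds_in_open) auto
    then show ?thesis by eventually_elim (use True in auto)
  next
    case False
    then have "\<forall>\<^sub>F y in nhds x. y \<in> {..<0}"
      using \<open>x \<noteq> 0\<close> by (intro eventually_nhds_in_open) auto
    then show ?thesis by eventually_elim (use False \<open>x \<noteq> 0\<close> in auto)
  qed
  ultimately show ?thesis by (subst DERIV_cong_ev[OF refl _ refl])
next
  case True
  \<comment> \<open>At 0 the difference quotient has size
    \<open>\<bar>h\<bar> powr (q - 1) / q\<close>, which vanishes in the limit because
    \<open>q > 1\<close>.\<close>
  have "((\<lambda>h. sgn h * \<bar>h\<bar> powr (q - 1) / q) \<longlongrightarrow> 0) (at 0)"
  proof (rule Lim_null_comparison)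
    show "\<forall>\<^sub>F h in at 0. norm (sgn h * \<bar>h\<bar> powr (q - 1) / q) \<le> \<bar>h\<bar> powr (q - 1) / q"
      using q by (auto simp: eventually_at_filter abs_mult)
    have "((\<lambda>h::real. \<bar>h\<bar> powr (q - 1) / q) \<longlongrightarrow> \<bar>0\<bar> powr (q - 1) / q) (at 0)"
      by (intro tendsto_intros tendsto_powr') (use q in auto)
    then show "((\<lambda>h::real. \<bar>h\<bar> powr (q - 1) / q) \<longlongrightarrow> 0) (at 0)" by simp
  qed
  moreover have "(\<bar>h\<bar> powr q / q) / h = sgn h * \<bar>h\<bar> powr (q - 1) / q" if "h \<noteq> 0" for h :: real
    using powr_add[of "\<bar>h\<bar>" "q - 1" 1] that q by (auto simp: field_simps sgn_if abs_if)
  ultimately have "((\<lambda>h. (\<bar>h\<bar> powr q / q) / h) \<longlongrightarrow> 0) (at 0)"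
    by (subst tendsto_cong[where g = "\<lambda>h. sgn h * \<bar>h\<bar> powr (q - 1) / q"])
      (auto simp: eventually_at_filter)
  then show ?thesis using True by (simp add: DERIV_def)
qed

lemma continuous_on_sgn_mult_abs_powr:
  fixes r :: real
  assumes "0 < r"
  shows "continuous_on UNIV (\<lambda>y. sgn y * \<bar>y\<bar> powr r)"
proof -
  \<comment> \<open>\<open>sgn\<close> jumps at 0, so the function is rewritten as the difference of
    powers of the positive and the negative part, each of them continuous.\<close>
  have "continuous_on UNIV (\<lambda>y::real. max y 0 powr r - max (- y) 0 powr r)"
    by (intro continuous_intros continuous_on_powr') (use assms in auto)
  also have "(\<lambda>y::real. max y 0 powr r - max (- y) 0 powr r) = (\<lambda>y. sgn y * \<bar>y\<bar> powr r)"
    by (auto simp: fun_eq_iff sgn_if max_def)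
  finally show ?thesis .
qed

lemma ac_primitive_abs_powr:
  assumes w: "ac_primitive A B w' w" and q: "1 < q"
  shows "ac_primitive A B (\<lambda>t. sgn (w t) * \<bar>w t\<bar> powr (q - 1) * w' t) (\<lambda>t. \<bar>w t\<bar> powr q / q)"
  by (rule ac_primitive_compose[OF w DERIV_abs_powr continuous_on_sgn_mult_abs_powr]) (use q in auto)

text \<open>For \<open>q = 1\<close>, where \<open>\<bar>\<cdot>\<bar>\<close> is not differentiable, the formula is the limit of the
  formulas for \<open>q = 1 + 1/n\<close>.\<close>

lemma has_integral_abs_powr:
  assumes w: "ac_primitive A B w' w" and q: "1 \<le> q" and AB: "A \<le> B"
  shows "((\<lambda>t. sgn (w t) * \<bar>w t\<bar> powr (q - 1) * w' t)
    has_integral (\<bar>w B\<bar> powr q - \<bar>w A\<bar> powr q) / q) {A..B}"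
proof (cases "q = 1")
  case False
  then show ?thesis
    using ac_primitiveD(2)[OF ac_primitive_abs_powr[OF w], of q A B] q AB
    by (simp add: diff_divide_distrib)
next
  case True
  define r where "r n = 1 / real (Suc n)" for n
  have r: "0 < r n" "r n \<le> 1" for n unfolding r_def by auto
  have r0: "r \<longlonglongrightarrow> 0" unfolding r_def using LIMSEQ_inverse_real_of_nat by (simp add: inverse_eq_divide)
  let ?f = "\<lambda>n t. sgn (w t) * \<bar>w t\<bar> powr (r n) * w' t"
  have fi: "(?f n has_integral (\<bar>w B\<bar> powr (1 + r n) - \<bar>w A\<bar> powr (1 + r n)) / (1 + r n)) {A..B}" for n
    using ac_primitiveD(2)[OF ac_primitive_abs_powr[OF w, of "1 + r n"], of A B] r[of n] AB
    by (simp add: diff_divide_distrib)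
  obtain M where M: "\<And>t. t \<in> {A..B} \<Longrightarrow> \<bar>w t\<bar> \<le> M" "1 \<le> M"
  proof -
    have "bounded (w ` {A..B})"
      by (intro compact_imp_bounded compact_continuous_image ac_primitive_continuous_on[OF w]) auto
    then obtain M where "\<forall>t\<in>{A..B}. \<bar>w t\<bar> \<le> M" unfolding bounded_iff by auto
    then have "\<bar>w t\<bar> \<le> max 1 M" if "t \<in> {A..B}" for t using that by (simp add: le_max_iff_disj)
    then show ?thesis by (rule that[of "max 1 M"]) simp_all
  qed
  have dom: "(\<lambda>t. M * \<bar>w' t\<bar>) integrable_on {A..B}"
    using ac_primitiveD(1)[OF w] by (intro integrable_on_mult_right) (auto simp: absolutely_integrable_on_def)
  \<comment> \<open>With \<open>r n \<le> 1 \<le> M\<close> the power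
    \<open>\<bar>w t\<bar> powr r n\<close> is at most \<open>M\<close> for every \<open>n\<close>,
    which yields one dominating function for the whole sequence.\<close>
  have bd: "norm (?f n t) \<le> M * \<bar>w' t\<bar>" if t: "t \<in> {A..B}" for n t
  proof -
    have "\<bar>w t\<bar> powr r n \<le> M powr r n" using M t r[of n] by (intro powr_mono2) auto
    also have "\<dots> \<le> M powr 1" using M r[of n] by (intro powr_mono) auto
    finally have "\<bar>sgn (w t)\<bar> * \<bar>w t\<bar> powr r n \<le> 1 * M"
      using M by (intro mult_mono) (auto simp: sgn_if)
    then show ?thesis by (simp add: abs_mult mult_right_mono)
  qed
  \<comment> \<open>Where \<open>w t = 0\<close> the factor \<open>sgn (w t)\<close> makes all terms
    zero; elsewhere the power is continuous in its exponent.\<close>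
  have ptw: "(\<lambda>n. ?f n t) \<longlonglongrightarrow> sgn (w t) * \<bar>w t\<bar> powr 0 * w' t" for t
  proof (cases "w t = 0")
    case False
    then show ?thesis by (intro tendsto_intros r0) auto
  qed simp
  have lim: "(\<lambda>n. \<bar>c\<bar> powr (1 + r n)) \<longlonglongrightarrow> \<bar>c\<bar> powr (1 + 0)" for c :: real
  proof (cases "c = 0")
    case False
    then show ?thesis by (intro tendsto_intros r0) auto
  qed simp
  have fi': "?f n integrable_on {A..B}" for n using fi by (rule has_integral_integrable)
  note int = dominated_convergence(1)[OF fi' dom bd ptw]
  have "(\<lambda>n. integral {A..B} (?f n)) \<longlonglongrightarrow> integral {A..B} (\<lambda>t. sgn (w t) * \<bar>w t\<bar> powr 0 * w' t)"
    by (rule dominated_convergence(2)[OF fi' dom bd ptw])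
  moreover have "(\<lambda>n. integral {A..B} (?f n)) \<longlonglongrightarrow> (\<bar>w B\<bar> powr (1 + 0) - \<bar>w A\<bar> powr (1 + 0)) / (1 + 0)"
    unfolding integral_unique[OF fi] by (intro tendsto_intros lim r0) auto
  ultimately have "integral {A..B} (\<lambda>t. sgn (w t) * \<bar>w t\<bar> powr 0 * w' t) = \<bar>w B\<bar> - \<bar>w A\<bar>"
    by (auto dest: LIMSEQ_unique)
  then show ?thesis using integrable_integral[OF int] True by simp
qed

subsection \<open>The values of k\<close>

lemma powr_abs_diff_le:
  fixes x y p :: real
  assumes "0 \<le> p"
  shows "\<bar>x - y\<bar> powr p \<le> 2 powr p * (\<bar>x\<bar> powr p + \<bar>y\<bar> powr p)"
proof -
  have "\<bar>x - y\<bar> powr p \<le> (2 * max \<bar>x\<bar> \<bar>y\<bar>) powr p"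
    by (rule powr_mono2) (use assms in auto)
  also have "\<dots> = 2 powr p * (max \<bar>x\<bar> \<bar>y\<bar>) powr p" by (rule powr_mult)
  also have "\<dots> \<le> 2 powr p * (\<bar>x\<bar> powr p + \<bar>y\<bar> powr p)"
    by (intro mult_left_mono) (auto simp: max_def)
  finally show ?thesis .
qed

text \<open>It bounds the denominator of k from below. For \<open>\<alpha> > 0\<close> it is
  convexity of the power at \<open>g\<close>, a convex combination of \<open>\<alpha>\<close> and
  \<open>\<beta>\<close>. For \<open>\<alpha> \<le> 0\<close> the \<open>\<alpha>\<close> term may
  be dropped, since \<open>(\<beta> - \<alpha>) * g \<le> (g - \<alpha>) * \<beta>\<close> and
  \<open>g powr (p - 1) \<le> \<beta> powr (p - 1)\<close>.\<close>

lemma powr_abs_convex_combination: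
  fixes g p :: real
  assumes p: "1 \<le> p" and g: "0 < g" and al: "\<alpha> < g" and be: "g < \<beta>"
  shows "(\<beta> - \<alpha>) * g powr p \<le> (\<beta> - g) * \<bar>\<alpha>\<bar> powr p + (g - \<alpha>) * \<bar>\<beta>\<bar> powr p"
proof (cases "\<alpha> > 0")
  case True
  let ?t = "(g - \<alpha>) / (\<beta> - \<alpha>)"
  have ab: "\<beta> - \<alpha> > 0" using al be by auto
  have t: "0 \<le> ?t" "?t \<le> 1" using al be by (auto simp: field_simps)
  have one: "(1 - ?t) * (\<beta> - \<alpha>) = \<beta> - g" "?t * (\<beta> - \<alpha>) = g - \<alpha>"
    using ab by (auto simp: field_simps)
  have "(1 - ?t) * \<alpha> + ?t * \<beta> = \<alpha> + ?t * (\<beta> - \<alpha>)" by (simp only: algebra_simps)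
  also have "\<dots> = g" unfolding one by simp
  finally have eq: "(1 - ?t) * \<alpha> + ?t * \<beta> = g" .
  have "((1 - ?t) *\<^sub>R \<alpha> + ?t *\<^sub>R \<beta>) powr p \<le> (1 - ?t) * \<alpha> powr p + ?t * \<beta> powr p"
    by (rule convex_onD[OF powr_convex[OF p] t]) (use True al be in auto)
  then have "g powr p \<le> (1 - ?t) * \<alpha> powr p + ?t * \<beta> powr p" unfolding real_scaleR_def eq .
  then have "(\<beta> - \<alpha>) * g powr p \<le> (\<beta> - \<alpha>) * ((1 - ?t) * \<alpha> powr p + ?t * \<beta> powr p)"
    using ab by (intro mult_left_mono) auto
  also have "\<dots> = ((1 - ?t) * (\<beta> - \<alpha>)) * \<alpha> powr p + (?t * (\<beta> - \<alpha>)) * \<beta> powr p"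
    by (simp only: algebra_simps)
  finally show ?thesis unfolding one using True al be by simp
next
  case False
  have split: "x powr p = x powr (p - 1) * x" if "x > 0" for x :: real
    using powr_add[of x "p - 1" 1] that by simp
  have "(\<beta> - \<alpha>) * g \<le> (g - \<alpha>) * \<beta>"
    using mult_left_mono[of g \<beta> "- \<alpha>"] False be by (simp add: algebra_simps)
  then have "((\<beta> - \<alpha>) * g) * g powr (p - 1) \<le> ((g - \<alpha>) * \<beta>) * \<beta> powr (p - 1)"
    by (rule mult_mono) (use p g al be powr_mono2 in auto)
  then have "(\<beta> - \<alpha>) * g powr p \<le> (g - \<alpha>) * \<beta> powr p"
    using g be by (simp add: split mult_ac)
  then show ?thesis using be g by (simp add: add_increasing)
qed

context
  fixes p a g :: real
  assumes p: "1 \<le> p" and a: "a < p - 1"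
  defines "g \<equiv> (p - 1 - a) / p"
begin

lemma crit_pos: "0 < g" unfolding g_def using p a by simp

lemma kfun_denominator_pos:
  assumes "\<alpha> < g" "g < \<beta>"
  shows "0 < (\<beta> - g) * \<bar>\<alpha>\<bar> powr p + (g - \<alpha>) * \<bar>\<beta>\<bar> powr p"
  using powr_abs_convex_combination[OF p crit_pos assms] crit_pos assms
  by (smt (verit) mult_pos_pos powr_gt_zero)

lemma kfun_le_iff:
  assumes "\<alpha> < g" "g < \<beta>"
  shows "kfun p a \<alpha> \<beta> \<le> C \<longleftrightarrow>
    (\<beta> - g) * \<bar>\<alpha> - 1\<bar> powr p + (g - \<alpha>) * \<bar>\<beta> - 1\<bar> powr p
      \<le> C * ((\<beta> - g) * \<bar>\<alpha>\<bar> powr p + (g - \<alpha>) * \<bar>\<beta>\<bar> powr p)"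
  unfolding kfun_def g_def[symmetric] by (rule pos_divide_le_eq[OF kfun_denominator_pos[OF assms]])

lemma kvaluesI: "\<alpha> < g \<Longrightarrow> g < \<beta> \<Longrightarrow> kfun p a \<alpha> \<beta> \<in> kvalues p a"
  unfolding kvalues_def g_def by auto

text \<open>Splitting \<open>\<bar>x - 1\<bar> powr p\<close> bounds the numerator by a multiple of
  \<open>D + (\<beta> - \<alpha>)\<close>, where \<open>D\<close> is the denominator, and convexity
  bounds \<open>\<beta> - \<alpha>\<close> by \<open>D / g powr p\<close>.\<close>

lemma bdd_above_kvalues: "bdd_above (kvalues p a)"
proof (rule bdd_aboveI)
  fix x assume "x \<in> kvalues p a"
  then obtain \<alpha> \<beta> where x: "x = kfun p a \<alpha> \<beta>" and ab: "\<alpha> < g" "g < \<beta>"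
    unfolding kvalues_def g_def by auto
  define D where "D = (\<beta> - g) * \<bar>\<alpha>\<bar> powr p + (g - \<alpha>) * \<bar>\<beta>\<bar> powr p"
  have "(\<beta> - g) * \<bar>\<alpha> - 1\<bar> powr p + (g - \<alpha>) * \<bar>\<beta> - 1\<bar> powr p
    \<le> (\<beta> - g) * (2 powr p * (\<bar>\<alpha>\<bar> powr p + 1)) + (g - \<alpha>) * (2 powr p * (\<bar>\<beta>\<bar> powr p + 1))"
    using powr_abs_diff_le[of p \<alpha> 1] powr_abs_diff_le[of p \<beta> 1] p ab
    by (intro add_mono mult_left_mono) auto
  also have "\<dots> = 2 powr p * (D + (\<beta> - \<alpha>))" unfolding D_def by (simp add: algebra_simps)
  also have "\<dots> \<le> 2 powr p * (D + D / g powr p)"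
    using powr_abs_convex_combination[OF p crit_pos ab] crit_pos
    unfolding D_def[symmetric] by (intro mult_left_mono add_left_mono) (auto simp: field_simps)
  also have "\<dots> = (2 powr p * (1 + 1 / g powr p)) * D" by (simp add: algebra_simps)
  finally show "x \<le> 2 powr p * (1 + 1 / g powr p)"
    unfolding x kfun_le_iff[OF ab] D_def .
qed

lemma kfun_le_Sup: "\<alpha> < g \<Longrightarrow> g < \<beta> \<Longrightarrow> kfun p a \<alpha> \<beta> \<le> Sup (kvalues p a)"
  by (intro cSup_upper kvaluesI bdd_above_kvalues)

text \<open>The values at \<open>(-n, n)\<close> tend to \<open>1\<close>.\<close>

lemma one_le_Sup_kvalues: "1 \<le> Sup (kvalues p a)"
proof -
  \<comment> \<open>This is a lower bound for k at \<open>(-n, n)\<close>: in the numerator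
    \<open>(n + 1) powr p\<close> is replaced by \<open>n powr p\<close> and the weight
    \<open>n + g\<close> by \<open>n\<close>, and the denominator is exactly
    \<open>2 * n * n powr p\<close>.\<close>
  define L where "L n = 1/2 * (1 - g / real n) + 1/2 * (1 - 1 / real n) powr p" for n
  have lim: "L \<longlonglongrightarrow> 1/2 * (1 - 0) + 1/2 * (1 - 0) powr p"
    unfolding L_def by (intro tendsto_intros lim_const_over_n) auto
  have ev: "\<forall>\<^sub>F n in sequentially. real n > max g 1"
    using filterlim_real_sequentially unfolding filterlim_at_top_dense by blast
  have "\<forall>\<^sub>F n in sequentially. L n \<le> Sup (kvalues p a)"
    using ev
  proof eventually_elim
    fix n assume n: "real n > max g 1"
    define x where "x = real n"
    have x: "x > g" "x > 1" using n by (auto simp: x_def)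
    have X: "x powr p > 0" using x by auto
    have l: "x powr p \<le> (x + 1) powr p" by (rule powr_mono2) (use x p in auto)
    have r: "(1 - 1/x) powr p * x powr p = (x - 1) powr p"
    proof -
      have "(1 - 1/x) powr p * x powr p = ((1 - 1/x) * x) powr p"
        by (rule powr_mult[symmetric])
      also have "(1 - 1/x) * x = x - 1" using x by (simp add: field_simps)
      finally show ?thesis .
    qed
    have "L n * (2 * x * x powr p) = (x - g) * x powr p + x * ((1 - 1/x) powr p * x powr p)"
      unfolding L_def x_def[symmetric] using x by (simp add: field_simps)
    also have "\<dots> \<le> (x - g) * (x + 1) powr p + (x + g) * (x - 1) powr p"
      unfolding r using x l crit_pos by (intro add_mono mult_left_mono mult_right_mono) auto
    also have "\<dots> = (x - g) * \<bar>- x - 1\<bar> powr p + (g - (- x)) * \<bar>x - 1\<bar> powr p"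
      using x by (simp add: add.commute)
    also have "\<dots> \<le> Sup (kvalues p a) * ((x - g) * \<bar>- x\<bar> powr p + (g - (- x)) * \<bar>x\<bar> powr p)"
      by (rule iffD1[OF kfun_le_iff kfun_le_Sup]) (use x crit_pos in auto)
    also have "\<dots> = Sup (kvalues p a) * (2 * x * x powr p)"
      using x by (simp add: algebra_simps)
    finally show "L n \<le> Sup (kvalues p a)"
      by (rule mult_right_le_imp_le) (use x X in auto)
  qed
  then have "1/2 * (1 - 0) + 1/2 * (1 - 0) powr p \<le> Sup (kvalues p a)"
    by (intro tendsto_upperbound[OF lim]) auto
  then show ?thesis by simp
qed

text \<open>That k is at most \<open>C\<close> means that each chord of \<open>G\<close> from a
  point left of \<open>g\<close> to a point right of \<open>g\<close> is nonpositive at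
  \<open>g\<close>. Hence every quotient \<open>G \<alpha> / (g - \<alpha>)\<close> is at most every
  quotient \<open>- G \<beta> / (\<beta> - g)\<close>, and a number between the two families is the
  required slope.\<close>

lemma exists_separating_slope:
  defines "C \<equiv> Sup (kvalues p a)"
  obtains m where "\<And>x. \<bar>x - 1\<bar> powr p - C * \<bar>x\<bar> powr p \<le> m * (g - x)"
proof -
  define G where "G x = \<bar>x - 1\<bar> powr p - C * \<bar>x\<bar> powr p" for x
  have G: "(\<beta> - g) * G \<alpha> + (g - \<alpha>) * G \<beta> \<le> 0" if "\<alpha> < g" "g < \<beta>" for \<alpha> \<beta>
    using kfun_le_Sup[OF that] unfolding kfun_le_iff[OF that] C_def[symmetric] G_def
    by (simp add: algebra_simps)
  define L where "L x = G x / (g - x)" for x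
  have LR: "L \<alpha> \<le> - G \<beta> / (\<beta> - g)" if "\<alpha> < g" "g < \<beta>" for \<alpha> \<beta>
    using G[OF that] that unfolding L_def by (simp add: field_simps)
  \<comment> \<open>The supremum of the left quotients separates the families; the right quotient at
    \<open>g + 1\<close> shows that it is finite.\<close>
  define m where "m = Sup (L ` {..<g})"
  have bdd: "bdd_above (L ` {..<g})"
    by (rule bdd_aboveI2[where M = "- G (g + 1) / (g + 1 - g)"]) (auto intro!: order_trans[OF LR[of _ "g + 1"]])
  have ne: "G x \<le> m * (g - x)" if "x \<noteq> g" for x
  proof (cases "x < g")
    case True
    then have "L x \<le> m" unfolding m_def by (intro cSup_upper bdd) auto
    then show ?thesis using True unfolding L_def by (simp add: field_simps)
  next
    case False
    then have x: "g < x" using that by auto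
    have "m \<le> - G x / (x - g)" unfolding m_def
      by (rule cSup_least) (use LR x in \<open>auto intro: exI[of _ "g - 1"]\<close>)
    then show ?thesis using x by (simp add: field_simps)
  qed
  \<comment> \<open>At \<open>g\<close> itself neither quotient says anything, so the inequality is
    carried over by continuity.\<close>
  have "isCont G g" unfolding G_def
    by (intro continuous_intros continuous_at_within_powr) (use p crit_pos in auto)
  then have lim: "(G \<longlongrightarrow> G g) (at g)" by (simp add: isCont_def)
  have lim2: "((\<lambda>x. m * (g - x)) \<longlongrightarrow> m * (g - g)) (at g)" by (intro tendsto_intros)
  have "G g \<le> m * (g - g)"
    by (rule tendsto_le[OF _ lim2 lim]) (auto simp: eventually_at_filter ne)
  then have "G x \<le> m * (g - x)" for x using ne[of x] by (cases "x = g") auto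
  then show ?thesis using that unfolding G_def by blast
qed

end

subsection \<open>The upper bound\<close>

text \<open>For \<open>w \<noteq> 0\<close> the slope inequality at \<open>x / w\<close> is
  multiplied by \<open>\<bar>w\<bar> powr p\<close>. For \<open>w = 0\<close> only
  \<open>\<bar>x\<bar> powr p \<le> C * \<bar>x\<bar> powr p\<close> is left, and this is where
  \<open>1 \<le> C\<close> enters.\<close>

lemma slope_inequality_homogeneous:
  fixes p C m g :: real
  assumes slope: "\<And>x. \<bar>x - 1\<bar> powr p - C * \<bar>x\<bar> powr p \<le> m * (g - x)" and C: "1 \<le> C"
  shows "\<bar>w - x\<bar> powr p \<le> C * \<bar>x\<bar> powr p + m * (g * w - x) * (sgn w * \<bar>w\<bar> powr (p - 1))"
proof (cases "w = 0")
  case True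
  then show ?thesis using mult_right_mono[OF C, of "\<bar>x\<bar> powr p"] by simp
next
  case False
  have w: "\<bar>w\<bar> powr p = w * (sgn w * \<bar>w\<bar> powr (p - 1))"
    using powr_add[of "\<bar>w\<bar>" 1 "p - 1"] False by (simp add: sgn_if abs_if)
  have "\<bar>w - x\<bar> = \<bar>w\<bar> * \<bar>x / w - 1\<bar>"
    using False by (simp add: abs_mult[symmetric] right_diff_distrib abs_minus_commute)
  then have "\<bar>w - x\<bar> powr p = \<bar>w\<bar> powr p * \<bar>x / w - 1\<bar> powr p" by (simp add: powr_mult)
  also have "\<dots> \<le> \<bar>w\<bar> powr p * (C * \<bar>x / w\<bar> powr p + m * (g - x / w))"
    using slope[of "x / w"] by (intro mult_left_mono) auto
  also have "\<dots> = C * (\<bar>w\<bar> * \<bar>x / w\<bar>) powr p + m * (\<bar>w\<bar> powr p * (g - x / w))"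
    by (simp only: powr_mult ring_distribs mult_ac)
  also have "\<bar>w\<bar> * \<bar>x / w\<bar> = \<bar>x\<bar>" using False by simp
  also have "\<bar>w\<bar> powr p * (g - x / w) = (g * w - x) * (sgn w * \<bar>w\<bar> powr (p - 1))"
    unfolding w using False by (simp add: field_simps)
  finally show ?thesis by (simp add: mult.assoc)
qed

section \<open>The primitive of f and the decay of w at both ends\<close>

lemma borel_measurable_lebesgue_on_id [measurable]: "(\<lambda>x. x) \<in> borel_measurable (lebesgue_on S)"
  by (intro measurable_restrict_space1 measurable_completion) simp

text \<open>A substitute for Hoelder's inequality that treats \<open>p = 1\<close> and
  \<open>p > 1\<close> alike: beyond the threshold \<open>c\<close> the factor
  \<open>y powr (1 - p)\<close> is at most \<open>c powr (1 - p)\<close>.\<close>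

lemma le_add_powr:
  fixes c y p :: real
  assumes "0 < c" "0 \<le> y" "1 \<le> p"
  shows "y \<le> c + c powr (1 - p) * y powr p"
proof (cases "y \<le> c")
  case False
  have "y = y powr (1 - p) * y powr p"
    using False assms by (simp add: powr_add[symmetric])
  also have "\<dots> \<le> c powr (1 - p) * y powr p"
    using False assms by (intro mult_right_mono powr_mono2') auto
  finally show ?thesis using assms by simp
qed (use assms in \<open>simp add: add_increasing2\<close>)

text \<open>The function is normalised to vanish on the closed negative half-line, so that the
  endpoint 0 contributes nothing and integrals over \<open>{0..}\<close> and \<open>{0<..}\<close>
  agree.\<close>

locale hardy_function =
  fixes p a g :: real and f :: "real \<Rightarrow> real"
  assumes p: "1 \<le> p" and a: "a < p - 1" and g_def: "g = (p - 1 - a) / p"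
    and meas: "f \<in> borel_measurable lebesgue" and f0: "\<And>t. t \<le> 0 \<Longrightarrow> f t = 0"
    and fin: "(\<lambda>t. \<bar>f t\<bar> powr p * t powr a) integrable_on {0..}"
begin

abbreviation "\<phi> t \<equiv> \<bar>f t\<bar> powr p * t powr a"

definition F :: "real \<Rightarrow> real" where "F t = integral {0..t} f"

definition w :: "real \<Rightarrow> real" where "w t = t powr (- g) * F t"

lemma g: "0 < g" unfolding g_def using p a by simp

lemma pg: "p * g = p - 1 - a" unfolding g_def using p by simp

lemma kernel_integrable:
  assumes "0 < t"
  shows "(\<lambda>s. \<phi> s * s powr g) integrable_on {0..t}"
proof (rule measurable_bounded_by_integrable_imp_integrable)
  have [measurable]: "f \<in> borel_measurable (lebesgue_on {0..t})"
    using meas by (rule measurable_restrict_space1)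
  show "(\<lambda>s. \<phi> s * s powr g) \<in> borel_measurable (lebesgue_on {0..t})"
    by measurable
  have "\<phi> integrable_on {0..t}"
    by (rule integrable_on_subinterval[OF fin]) auto
  then show "(\<lambda>s. \<phi> s * t powr g) integrable_on {0..t}"
    by (rule integrable_on_mult_left)
  show "norm (\<phi> s * s powr g) \<le> \<phi> s * t powr g" if "s \<in> {0..t}" for s
    using that g by (auto intro!: mult_left_mono powr_mono2)
qed auto

text \<open>This is \<open>le_add_powr\<close> for
  \<open>y = \<bar>f s\<bar> * s powr (1 - g)\<close>, multiplied by \<open>s powr (g - 1)\<close>;
  the exponents match because \<open>p * g = p - 1 - a\<close>. Since \<open>g > 0\<close>, the
  first term is integrable at 0.\<close>

lemma abs_le_kernel:
  assumes c: "0 < c" and s: "0 \<le> s"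
  shows "\<bar>f s\<bar> \<le> c * s powr (g - 1) + c powr (1 - p) * (\<phi> s * s powr g)"
proof (cases "s = 0")
  case False
  then have s: "s > 0" using s by auto
  have e: "(s powr (1 - g)) powr p * s powr (g - 1) = s powr a * s powr g"
  proof -
    have "(1 - g) * p + (g - 1) = a + g" using pg by (simp add: algebra_simps)
    then show ?thesis by (simp only: powr_powr powr_add[symmetric])
  qed
  have "\<bar>f s\<bar> = (\<bar>f s\<bar> * s powr (1 - g)) * s powr (g - 1)"
    using s by (simp add: powr_add[symmetric])
  also have "\<dots> \<le> (c + c powr (1 - p) * (\<bar>f s\<bar> * s powr (1 - g)) powr p) * s powr (g - 1)"
    by (intro mult_right_mono le_add_powr c p) auto
  also have "\<dots> = c * s powr (g - 1)
      + c powr (1 - p) * (\<bar>f s\<bar> powr p * ((s powr (1 - g)) powr p * s powr (g - 1)))"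
    by (simp add: powr_mult algebra_simps)
  finally show ?thesis unfolding e by (simp add: mult_ac)
qed (simp add: f0)

lemma kernel_has_integral:
  assumes t: "0 < t"
  shows "((\<lambda>s. c * s powr (g - 1) + c powr (1 - p) * (\<phi> s * s powr g)) has_integral
      c * (t powr g / g) + c powr (1 - p) * integral {0..t} (\<lambda>s. \<phi> s * s powr g)) {0..t}"
  using has_integral_powr_from_0[of "g - 1" t] g t
  by (intro has_integral_add has_integral_mult_right integrable_integral kernel_integrable) auto

lemma absolutely_integrable_on_initial:
  assumes t: "0 < t"
  shows "f absolutely_integrable_on {0..t}"
proof (rule measurable_bounded_by_integrable_imp_absolutely_integrable)
  show "f \<in> borel_measurable (lebesgue_on {0..t})"
    using meas by (rule measurable_restrict_space1)
  show "(\<lambda>s. 1 * s powr (g - 1) + 1 powr (1 - p) * (\<phi> s * s powr g)) integrable_on {0..t}"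
    using kernel_has_integral[OF t, of 1] by (rule has_integral_integrable)
  show "norm (f s) \<le> 1 * s powr (g - 1) + 1 powr (1 - p) * (\<phi> s * s powr g)" if "s \<in> {0..t}" for s
    using abs_le_kernel[of 1 s] that by auto
qed auto

text \<open>The parameter \<open>c\<close> stays free so that the first term can be made small
  before the second one is sent to 0.\<close>

lemma abs_w_le:
  assumes t: "0 < t" and c: "0 < c"
  shows "\<bar>w t\<bar> \<le> c / g + c powr (1 - p) * (t powr (- g) * integral {0..t} (\<lambda>s. \<phi> s * s powr g))"
proof -
  have "\<bar>F t\<bar> \<le> integral {0..t} (\<lambda>s. c * s powr (g - 1) + c powr (1 - p) * (\<phi> s * s powr g))"
    unfolding F_def real_norm_def[symmetric]
    by (rule integral_norm_bound_integral)
      (use absolutely_integrable_on_initial[OF t] kernel_has_integral[OF t] abs_le_kernel[OF c] in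
        \<open>auto simp: absolutely_integrable_on_def intro: has_integral_integrable\<close>)
  also have "\<dots> = c * (t powr g / g) + c powr (1 - p) * integral {0..t} (\<lambda>s. \<phi> s * s powr g)"
    by (rule integral_unique[OF kernel_has_integral[OF t]])
  finally have "t powr (- g) * \<bar>F t\<bar> \<le> t powr (- g) * \<dots>" by (rule mult_left_mono) auto
  also have "\<dots> = c * (t powr (- g) * t powr g) / g
      + c powr (1 - p) * (t powr (- g) * integral {0..t} (\<lambda>s. \<phi> s * s powr g))"
    by (simp add: algebra_simps)
  also have "t powr (- g) * t powr g = 1" using t by (simp add: powr_add[symmetric])
  finally show ?thesis unfolding w_def by (simp add: abs_mult)
qed

text \<open>One argument serves both ends. The integral term of \<open>abs_w_le\<close> is the
  integral of \<open>\<phi> s\<close> against the kernel \<open>(s / \<tau> n) powr g\<close> cut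
  off at \<open>\<tau> n\<close>. The kernel is at most 1 and tends to 0 pointwise, so dominated
  convergence applies.\<close>

lemma w_tendsto_0:
  assumes \<tau>: "\<And>n. 0 < \<tau> n"
    and lim: "\<And>s. 0 < s \<Longrightarrow> (\<lambda>n. if s \<le> \<tau> n then (s / \<tau> n) powr g else 0) \<longlonglongrightarrow> 0"
  shows "(\<lambda>n. w (\<tau> n)) \<longlonglongrightarrow> 0"
proof -
  define G where "G n = \<tau> n powr (- g) * integral {0..\<tau> n} (\<lambda>s. \<phi> s * s powr g)" for n
  let ?h = "\<lambda>n s. \<phi> s * (if s \<le> \<tau> n then (s / \<tau> n) powr g else 0)"
  have h: "(?h n has_integral G n) {0..}" for n
  proof -
    have "((\<lambda>s. \<tau> n powr (- g) * (\<phi> s * s powr g)) has_integral G n) {0..\<tau> n}"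
      unfolding G_def by (intro has_integral_mult_right integrable_integral kernel_integrable \<tau>)
    moreover have "\<tau> n powr (- g) * (\<phi> s * s powr g) = ?h n s" if "s \<in> {0..\<tau> n}" for s
      using that \<tau>[of n] by (simp add: powr_divide powr_minus_divide)
    ultimately have "(?h n has_integral G n) {0..\<tau> n}"
      by (rule has_integral_eq[rotated])
    then show ?thesis
      by (rule has_integral_on_superset) (auto simp: f0)
  qed
  have "(\<lambda>n. integral {0..} (?h n)) \<longlonglongrightarrow> integral {0..} (\<lambda>s::real. 0 :: real)"
  proof (rule dominated_convergence(2)[OF has_integral_integrable[OF h] fin])
    fix n and s :: real assume s: "s \<in> {0..}"
    have "(if s \<le> \<tau> n then (s / \<tau> n) powr g else 0) \<le> 1"
      using s \<tau>[of n] g powr_mono2[of g "s / \<tau> n" 1] by auto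
    then show "norm (?h n s) \<le> \<phi> s" by (auto simp: abs_mult mult_left_le)
  next
    fix s :: real assume s: "s \<in> {0..}"
    show "(\<lambda>n. ?h n s) \<longlonglongrightarrow> 0"
    proof (cases "s = 0")
      case False
      then have "(\<lambda>n. ?h n s) \<longlonglongrightarrow> \<phi> s * 0"
        using s by (intro tendsto_mult tendsto_const lim) auto
      then show ?thesis by simp
    qed simp
  qed
  then have G: "G \<longlonglongrightarrow> 0" unfolding integral_unique[OF h] by simp
  show ?thesis
  proof (rule LIMSEQ_I)
    fix e :: real assume e: "0 < e"
    \<comment> \<open>This makes the term \<open>c / g\<close> of \<open>abs_w_le\<close> equal to
      \<open>e / 2\<close>.\<close>
    define c where "c = e * g / 2"
    have c: "c > 0" unfolding c_def using e g by simp
    have "(\<lambda>n. c powr (1 - p) * G n) \<longlonglongrightarrow> c powr (1 - p) * 0" by (intro tendsto_intros G)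
    then have "\<forall>\<^sub>F n in sequentially. c powr (1 - p) * G n < e / 2"
      using e by (intro order_tendstoD(2)[where y = 0]) auto
    then obtain N where N: "\<And>n. n \<ge> N \<Longrightarrow> c powr (1 - p) * G n < e / 2"
      unfolding eventually_sequentially by auto
    have "\<bar>w (\<tau> n)\<bar> \<le> e / 2 + c powr (1 - p) * G n" for n
      using abs_w_le[OF \<tau> c, of n] g unfolding G_def c_def by simp
    then have "norm (w (\<tau> n) - 0) < e" if "n \<ge> N" for n
      using N[OF that] by (smt (verit) field_sum_of_halves real_norm_def)
    then show "\<exists>N. \<forall>n\<ge>N. norm (w (\<tau> n) - 0) < e" by blast
  qed
qed

lemma w_tendsto_0_left: "(\<lambda>n. w (1 / real (Suc n))) \<longlonglongrightarrow> 0"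
proof (rule w_tendsto_0)
  fix s :: real assume s: "0 < s"
  \<comment> \<open>Near 0 the cut-off does the work: the kernel at \<open>s\<close> is exactly zero
    once the endpoint has passed below \<open>s\<close>.\<close>
  have "\<forall>\<^sub>F n in sequentially. 1 / real (Suc n) < s"
    using order_tendstoD(2)[OF LIMSEQ_inverse_real_of_nat s] by (simp add: inverse_eq_divide)
  then show "(\<lambda>n. if s \<le> 1 / real (Suc n) then (s / (1 / real (Suc n))) powr g else 0) \<longlonglongrightarrow> 0"
    by (rule tendsto_eventually[OF eventually_mono]) auto
qed simp

lemma w_tendsto_0_right: "(\<lambda>n. w (real (Suc n))) \<longlonglongrightarrow> 0"
proof (rule w_tendsto_0)
  fix s :: real assume s: "0 < s"
  have "(\<lambda>n. s * inverse (real (Suc n))) \<longlonglongrightarrow> s * 0"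
    by (intro tendsto_intros LIMSEQ_inverse_real_of_nat)
  then have "(\<lambda>n. (s / real (Suc n)) powr g) \<longlonglongrightarrow> 0 powr g"
    using s g by (intro tendsto_powr') (auto simp: divide_inverse)
  then have lim: "(\<lambda>n. (s / real (Suc n)) powr g) \<longlonglongrightarrow> 0" by simp
  show "(\<lambda>n. if s \<le> real (Suc n) then (s / real (Suc n)) powr g else 0) \<longlonglongrightarrow> 0"
    by (rule Lim_null_comparison[OF _ lim]) auto
qed simp

lemma ac_primitive_F:
  assumes "0 \<le> A" "0 < B"
  shows "ac_primitive A B f F"
proof -
  have "ac_primitive 0 B f F"
    unfolding F_def by (rule ac_primitiveI) (use assms absolutely_integrable_on_initial in auto)
  then show ?thesis
    using assms unfolding ac_primitive_def
    by (auto intro: absolutely_integrable_on_subinterval)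
qed

lemma ac_primitive_w:
  assumes A: "0 < A" and B: "0 < B"
  shows "ac_primitive A B (\<lambda>t. - g * t powr (- g - 1) * F t + t powr (- g) * f t) w"
proof -
  have "ac_primitive A B (\<lambda>t. - g * t powr (- g - 1)) (\<lambda>t. t powr (- g))"
    by (rule ac_primitive_C1) (use A in \<open>auto intro!: derivative_eq_intros continuous_intros\<close>)
  from ac_primitive_mult[OF this ac_primitive_F] A B show ?thesis
    unfolding w_def by simp
qed

section \<open>The integrated inequality on compact intervals\<close>

context
  fixes C m :: real
  assumes slope: "\<And>x. \<bar>x - 1\<bar> powr p - C * \<bar>x\<bar> powr p \<le> m * (g - x)" and C: "1 \<le> C"
begin

text \<open>In the variables \<open>w\<close> and \<open>x\<close> one has
  \<open>F t / t - f t = t powr (g - 1) * (w t - x)\<close>, and the choice of \<open>g\<close>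
  turns the weight \<open>t powr ((g - 1) * p + a)\<close> into \<open>1 / t\<close>. The derivative
  of \<open>w\<close> is \<open>(x - g * w t) / t\<close>, so the last term of the homogeneous
  inequality becomes the subtracted derivative term.\<close>

lemma pointwise_bound:
  assumes t: "0 < t"
  shows "\<bar>F t / t - f t\<bar> powr p * t powr a \<le> C * \<phi> t
    - m * (sgn (w t) * \<bar>w t\<bar> powr (p - 1) * (- g * t powr (- g - 1) * F t + t powr (- g) * f t))"
proof -
  define x where "x = t powr (1 - g) * f t"
  have fx: "f t = t powr (g - 1) * x" unfolding x_def using t by (simp add: mult.assoc[symmetric] powr_add[symmetric])
  have Fw: "F t / t = t powr (g - 1) * w t" 
  proof -
    have "t powr (g - 1) * t powr (- g) = 1 / t"
      using t powr_minus_divide[of t 1] by (simp add: powr_add[symmetric])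
    then show ?thesis unfolding w_def by (simp only: mult.assoc[symmetric]) simp
  qed
  have e: "(t powr (g - 1)) powr p * t powr a = 1 / t"
  proof -
    have "(g - 1) * p + a = -1" using pg by (simp add: algebra_simps)
    then show ?thesis using t powr_minus_divide[of t 1] by (simp add: powr_powr powr_add[symmetric])
  qed
  have d: "- g * t powr (- g - 1) * F t + t powr (- g) * f t = 1 / t * (x - g * w t)"
    unfolding w_def x_def using t powr_add[of t 1 "- g"] powr_diff[of t "-g" 1]
    by (simp add: field_simps)
  have "\<bar>F t / t - f t\<bar> powr p * t powr a = \<bar>w t - x\<bar> powr p * ((t powr (g - 1)) powr p * t powr a)"
    unfolding fx Fw right_diff_distrib[symmetric] abs_mult by (simp add: powr_mult)
  also have "\<dots> \<le> (C * \<bar>x\<bar> powr p + m * (g * w t - x) * (sgn (w t) * \<bar>w t\<bar> powr (p - 1)))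
      * ((t powr (g - 1)) powr p * t powr a)"
    by (intro mult_right_mono slope_inequality_homogeneous slope C) auto
  also have "\<dots> = C * (\<bar>x\<bar> powr p * ((t powr (g - 1)) powr p * t powr a))
      + m * (g * w t - x) * (sgn (w t) * \<bar>w t\<bar> powr (p - 1)) * (1 / t)"
    unfolding e by (simp add: algebra_simps)
  also have "\<bar>x\<bar> powr p * ((t powr (g - 1)) powr p * t powr a) = \<phi> t"
    unfolding fx abs_mult by (simp add: powr_mult)
  finally show ?thesis unfolding d by (simp add: algebra_simps)
qed

text \<open>Integrating \<open>pointwise_bound\<close> leaves only boundary values of
  \<open>\<bar>w\<bar> powr p\<close>. Its right-hand side also dominates the nonnegative left-hand
  side, which gives integrability.\<close>

lemma bound_on_compact:
  assumes A: "0 < A" and AB: "A \<le> B"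
  shows "(\<lambda>t. \<bar>F t / t - f t\<bar> powr p * t powr a) integrable_on {A..B}"
    and "integral {A..B} (\<lambda>t. \<bar>F t / t - f t\<bar> powr p * t powr a)
      \<le> C * integral {0..} \<phi> - m * ((\<bar>w B\<bar> powr p - \<bar>w A\<bar> powr p) / p)"
proof -
  let ?w' = "\<lambda>t. sgn (w t) * \<bar>w t\<bar> powr (p - 1) * (- g * t powr (- g - 1) * F t + t powr (- g) * f t)"
  have phi: "\<phi> integrable_on {A..B}" by (rule integrable_on_subinterval[OF fin]) (use A in auto)
  have "(?w' has_integral (\<bar>w B\<bar> powr p - \<bar>w A\<bar> powr p) / p) {A..B}"
    by (rule has_integral_abs_powr[OF ac_primitive_w p AB]) (use A AB in auto)
  then have rhs: "((\<lambda>t. C * \<phi> t - m * ?w' t) has_integral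
      C * integral {A..B} \<phi> - m * ((\<bar>w B\<bar> powr p - \<bar>w A\<bar> powr p) / p)) {A..B}"
    by (intro has_integral_diff has_integral_mult_right integrable_integral phi)
  have Fc: "continuous_on {A..B} F"
    by (rule ac_primitive_continuous_on[OF ac_primitive_F]) (use A AB in auto)
  have [measurable]: "f \<in> borel_measurable (lebesgue_on {A..B})" "F \<in> borel_measurable (lebesgue_on {A..B})"
    using meas continuous_imp_measurable_on_sets_lebesgue[OF Fc]
    by (auto intro: measurable_restrict_space1)
  show int: "(\<lambda>t. \<bar>F t / t - f t\<bar> powr p * t powr a) integrable_on {A..B}"
  proof (rule measurable_bounded_by_integrable_imp_integrable)
    show "(\<lambda>t. \<bar>F t / t - f t\<bar> powr p * t powr a) \<in> borel_measurable (lebesgue_on {A..B})"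
      by measurable
    show "(\<lambda>t. C * \<phi> t - m * ?w' t) integrable_on {A..B}" using rhs by (rule has_integral_integrable)
    show "norm (\<bar>F t / t - f t\<bar> powr p * t powr a) \<le> C * \<phi> t - m * ?w' t" if "t \<in> {A..B}" for t
      using pointwise_bound[of t] that A by simp
  qed auto
  have "integral {A..B} (\<lambda>t. \<bar>F t / t - f t\<bar> powr p * t powr a)
      \<le> C * integral {A..B} \<phi> - m * ((\<bar>w B\<bar> powr p - \<bar>w A\<bar> powr p) / p)"
    by (rule has_integral_le[OF integrable_integral[OF int] rhs]) (use pointwise_bound A in auto)
  also have "integral {A..B} \<phi> \<le> integral {0..} \<phi>"
    by (rule integral_subset_le[OF _ phi fin]) (use A in auto)
  finally show "integral {A..B} (\<lambda>t. \<bar>F t / t - f t\<bar> powr p * t powr a)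
      \<le> C * integral {0..} \<phi> - m * ((\<bar>w B\<bar> powr p - \<bar>w A\<bar> powr p) / p)"
    using C by simp
qed

end

end

section \<open>Exhaustion of the half-line\<close>

context hardy_function
begin

lemma hardy_eq:
  assumes "0 < t"
  shows "hardy f t = F t / t"
  using set_lebesgue_integral_eq_integral(2)[OF absolutely_integrable_on_initial[OF assms]]
  unfolding hardy_def F_def by simp

lemma nn_integral_norm: "(\<integral>\<^sup>+t\<in>{0<..}. ennreal (\<phi> t) \<partial>lebesgue) = ennreal (integral {0..} \<phi>)"
proof -
  have "(\<integral>\<^sup>+t\<in>{0<..}. ennreal (\<phi> t) \<partial>lebesgue) = (\<integral>\<^sup>+t\<in>{0..}. ennreal (\<phi> t) \<partial>lebesgue)"
    by (intro nn_integral_cong) (auto simp: indicator_def f0)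
  also have "\<dots> = ennreal (integral {0..} \<phi>)"
    unfolding nn_integral_completion
    by (rule nn_integral_has_integral_lebesgue'[OF _ integrable_integral[OF fin]]) auto
  finally show ?thesis .
qed

text \<open>The intervals \<open>J n\<close> increase to the positive half-line, so monotone
  convergence handles the left-hand side, while the boundary terms \<open>e n\<close> tend to 0 with
  \<open>w\<close>.\<close>

lemma nn_integral_hardy_minus_id_le:
  fixes C m :: real
  assumes slope: "\<And>x. \<bar>x - 1\<bar> powr p - C * \<bar>x\<bar> powr p \<le> m * (g - x)" and C: "1 \<le> C"
  shows "(\<integral>\<^sup>+t\<in>{0<..}. ennreal (\<bar>hardy f t - f t\<bar> powr p * t powr a) \<partial>lebesgue)
    \<le> ennreal (C * integral {0..} \<phi>)"
proof -
  define u where "u t = \<bar>F t / t - f t\<bar> powr p * t powr a" for t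
  define J where "J n = {1 / real (Suc n)..real (Suc n)}" for n
  define U where "U n t = ennreal (u t) * indicator (J n) t" for n t
  define e where "e n = m * ((\<bar>w (real (Suc n))\<bar> powr p - \<bar>w (1 / real (Suc n))\<bar> powr p) / p)" for n
  note bound = bound_on_compact[OF slope C, folded u_def]
  have J: "0 < 1 / real (Suc n)" "1 / real (Suc n) \<le> real (Suc n)" for n
    by (auto simp: field_simps)
  have meas_U: "U n \<in> borel_measurable lebesgue" for n
  proof -
    have "(\<lambda>t. indicator (J n) t *\<^sub>R u t) \<in> borel_measurable lebesgue"
      using integrable_integral[OF bound(1)[OF J]] unfolding J_def
      by (rule has_integral_implies_lebesgue_measurable)
    then have "(\<lambda>t. ennreal (indicator (J n) t *\<^sub>R u t)) \<in> borel_measurable lebesgue" by simp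
    also have "(\<lambda>t. ennreal (indicator (J n) t *\<^sub>R u t)) = U n"
      unfolding U_def by (auto simp: fun_eq_iff indicator_def)
    finally show ?thesis .
  qed
  have mono_J: "J i \<subseteq> J j" if "i \<le> j" for i j
  proof -
    have "1 / real (Suc j) \<le> 1 / real (Suc i)" using that by (intro divide_left_mono) auto
    then show ?thesis using that unfolding J_def by (intro atLeastatMost_subset_iff[THEN iffD2]) simp
  qed
  have "(\<lambda>n. \<integral>\<^sup>+t. U n t \<partial>lebesgue) \<longlonglongrightarrow> (\<integral>\<^sup>+t\<in>{0<..}. ennreal (u t) \<partial>lebesgue)"
  proof (rule nn_integral_LIMSEQ)
    show "incseq U"
      unfolding incseq_def le_fun_def U_def
      using mono_J by (auto simp: indicator_def)
    show "U n \<in> borel_measurable lebesgue" for n by (rule meas_U)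
    fix t :: real
    show "(\<lambda>n. U n t) \<longlonglongrightarrow> ennreal (u t) * indicator {0<..} t"
    proof (cases "0 < t")
      case True
      then obtain N where N: "max t (1 / t) < real N" using reals_Archimedean2 by blast
      have "t \<in> J N" unfolding J_def using N True by (auto simp: field_simps)
      then have "t \<in> J n" if "n \<ge> N" for n using mono_J that by blast
      then have "\<forall>\<^sub>F n in sequentially. U n t = ennreal (u t) * indicator {0<..} t"
        using True unfolding eventually_sequentially U_def by (auto intro!: exI[of _ N])
      then show ?thesis by (rule tendsto_eventually)
    next
      case False
      have "t \<notin> J n" for n 
        using False J(1)[of n] unfolding J_def atLeastAtMost_iff by linarith
      then show ?thesis using False unfolding U_def by simp
    qed
  qed
  moreover have "(\<lambda>n. ennreal (C * integral {0..} \<phi> - e n)) \<longlonglongrightarrow> ennreal (C * integral {0..} \<phi> - 0)"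
  proof (intro tendsto_ennrealI tendsto_diff tendsto_const)
    have "e \<longlonglongrightarrow> m * ((\<bar>0\<bar> powr p - \<bar>0\<bar> powr p) / p)"
      unfolding e_def
      by (intro tendsto_intros tendsto_powr' w_tendsto_0_left w_tendsto_0_right) (use p in auto)
    then show "e \<longlonglongrightarrow> 0" by simp
  qed
  moreover have "(\<integral>\<^sup>+t. U n t \<partial>lebesgue) \<le> ennreal (C * integral {0..} \<phi> - e n)" for n
  proof -
    have "(\<integral>\<^sup>+t. U n t \<partial>lebesgue) = ennreal (integral (J n) u)"
      unfolding U_def nn_integral_completion
      by (rule nn_integral_has_integral_lebesgue'[OF _ integrable_integral])
        (use bound(1)[OF J, of n] in \<open>simp_all add: J_def u_def\<close>)
    also have "\<dots> \<le> ennreal (C * integral {0..} \<phi> - e n)"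
      unfolding J_def e_def by (intro ennreal_leI bound(2) J)
    finally show ?thesis .
  qed
  ultimately have "(\<integral>\<^sup>+t\<in>{0<..}. ennreal (u t) \<partial>lebesgue) \<le> ennreal (C * integral {0..} \<phi> - 0)"
    by (intro LIMSEQ_le) auto
  moreover have "(\<integral>\<^sup>+t\<in>{0<..}. ennreal (u t) \<partial>lebesgue)
      = (\<integral>\<^sup>+t\<in>{0<..}. ennreal (\<bar>hardy f t - f t\<bar> powr p * t powr a) \<partial>lebesgue)"
    by (intro nn_integral_cong) (auto simp: indicator_def u_def hardy_eq)
  ultimately show ?thesis by simp
qed

end

lemma hardy_minus_id_bound_of_Sup_le:
  assumes p: "1 \<le> p" and a: "a < p - 1" and K: "0 \<le> K" "Sup (kvalues p a) \<le> K powr p"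
  shows "hardy_minus_id_bound p a K"
  unfolding hardy_minus_id_bound_def
proof (intro conjI ballI impI K(1))
  fix f assume f: "f \<in> borel_measurable (lebesgue_on {0::real..})"
    and fin: "(\<integral>\<^sup>+t\<in>{0<..}. ennreal (\<bar>f t\<bar> powr p * t powr a) \<partial>lebesgue) < \<infinity>"
  \<comment> \<open>\<open>f\<close> is arbitrary at 0 and on the negative axis, whereas the locale
    demands zeros there.\<close>
  define f' where "f' t = (if 0 < t then f t else 0)" for t
  have ind: "(\<lambda>t. indicator {0..} t *\<^sub>R f t) \<in> borel_measurable lebesgue"
    using f by (subst (asm) borel_measurable_restrict_space_iff) auto
  have "(\<lambda>t. indicator {0<..} t *\<^sub>R (indicator {0..} t *\<^sub>R f t)) \<in> borel_measurable lebesgue"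
    by (rule borel_measurable_scaleR[OF borel_measurable_indicator ind]) simp
  also have "(\<lambda>t. indicator {0<..} t *\<^sub>R (indicator {0..} t *\<^sub>R f t)) = f'"
    by (auto simp: fun_eq_iff f'_def indicator_def)
  finally have meas: "f' \<in> borel_measurable lebesgue" .
  have [measurable]: "(\<lambda>t. \<bar>f' t\<bar> powr p * t powr a) \<in> borel_measurable lebesgue"
  proof -
    have [measurable]: "(\<lambda>t. t :: real) \<in> borel_measurable lebesgue" by (rule measurable_completion) simp
    show ?thesis using meas by measurable
  qed
  have f_f': "(\<integral>\<^sup>+t\<in>{0<..}. ennreal (\<bar>f t\<bar> powr p * t powr a) \<partial>lebesgue)
      = (\<integral>\<^sup>+t. ennreal (\<bar>f' t\<bar> powr p * t powr a) \<partial>lebesgue)"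
    by (intro nn_integral_cong) (auto simp: f'_def indicator_def)
  have "integrable lebesgue (\<lambda>t. \<bar>f' t\<bar> powr p * t powr a)"
    by (rule integrableI_nonneg) (use fin f_f' in auto)
  then have "(\<lambda>t. \<bar>f' t\<bar> powr p * t powr a) absolutely_integrable_on UNIV"
    by (simp add: set_integrable_def)
  then have int: "(\<lambda>t. \<bar>f' t\<bar> powr p * t powr a) integrable_on {0..}"
    by (rule set_lebesgue_integral_eq_integral(1)[OF set_integrable_subset]) auto
  have "f' t = 0" if "t \<le> 0" for t using that by (simp add: f'_def)
  then interpret hardy_function p a "(p - 1 - a) / p" f'
    by (rule hardy_function.intro[OF p a refl meas _ int])
  obtain m where "\<And>x. \<bar>x - 1\<bar> powr p - Sup (kvalues p a) * \<bar>x\<bar> powr p \<le> m * ((p - 1 - a) / p - x)"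
    using exists_separating_slope[OF p a] by blast
  note le = nn_integral_hardy_minus_id_le[OF this one_le_Sup_kvalues[OF p a]]
  have AE: "AE t in lebesgue. t \<noteq> (0::real)"
    by (rule AE_completion) (rule AE_lborel_singleton)
  \<comment> \<open>The average over \<open>{0..t}\<close> sees the point 0, where \<open>f\<close>
    and \<open>f'\<close> may differ, but a single point is a null set.\<close>
  have hardy_f': "hardy f t = hardy f' t" if "0 < t" for t
  proof -
    have "(LINT s:{0..t}|lebesgue. f s) = (LINT s:{0..t}|lebesgue. f' s)"
      unfolding set_lebesgue_integral_def
    proof (rule integral_cong_AE)
      have "(\<lambda>s. indicator {0..t} s *\<^sub>R (indicator {0..} s *\<^sub>R f s)) \<in> borel_measurable lebesgue"
        by (rule borel_measurable_scaleR[OF borel_measurable_indicator ind]) simp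
      also have "(\<lambda>s. indicator {0..t} s *\<^sub>R (indicator {0..} s *\<^sub>R f s)) = (\<lambda>s. indicator {0..t} s *\<^sub>R f s)"
        by (auto simp: fun_eq_iff indicator_def)
      finally show "(\<lambda>s. indicator {0..t} s *\<^sub>R f s) \<in> borel_measurable lebesgue" .
      show "(\<lambda>s. indicator {0..t} s *\<^sub>R f' s) \<in> borel_measurable lebesgue"
        by (rule borel_measurable_scaleR[OF borel_measurable_indicator meas]) simp
      show "AE s in lebesgue. indicator {0..t} s *\<^sub>R f s = indicator {0..t} s *\<^sub>R f' s"
        using AE by eventually_elim (auto simp: f'_def indicator_def)
    qed
    then show ?thesis unfolding hardy_def by simp
  qed
  have "(\<integral>\<^sup>+t\<in>{0<..}. ennreal (\<bar>hardy f t - f t\<bar> powr p * t powr a) \<partial>lebesgue)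
      = (\<integral>\<^sup>+t\<in>{0<..}. ennreal (\<bar>hardy f' t - f' t\<bar> powr p * t powr a) \<partial>lebesgue)"
    by (intro nn_integral_cong) (auto simp: f'_def hardy_f' indicator_def)
  also have "\<dots> \<le> ennreal (K powr p * integral {0..} (\<lambda>t. \<bar>f' t\<bar> powr p * t powr a))"
    by (rule order_trans[OF le])
      (intro ennreal_leI mult_right_mono K(2) integral_nonneg[OF local.fin], auto)
  also have "\<dots> = ennreal (K powr p) * (\<integral>\<^sup>+t\<in>{0<..}. ennreal (\<bar>f' t\<bar> powr p * t powr a) \<partial>lebesgue)"
    unfolding nn_integral_norm by (rule ennreal_mult') simp
  also have "(\<integral>\<^sup>+t\<in>{0<..}. ennreal (\<bar>f' t\<bar> powr p * t powr a) \<partial>lebesgue)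
      = (\<integral>\<^sup>+t\<in>{0<..}. ennreal (\<bar>f t\<bar> powr p * t powr a) \<partial>lebesgue)"
    by (intro nn_integral_cong) (auto simp: f'_def indicator_def)
  finally show "(\<integral>\<^sup>+t\<in>{0<..}. ennreal (\<bar>hardy f t - f t\<bar> powr p * t powr a) \<partial>lebesgue)
    \<le> ennreal (K powr p) * (\<integral>\<^sup>+t\<in>{0<..}. ennreal (\<bar>f t\<bar> powr p * t powr a) \<partial>lebesgue)" .
qed

subsection \<open>The lower bound\<close>

text \<open>The coefficients \<open>b\<close> and \<open>c\<close> are independent of the exponents
  so that one family contains the test function (\<open>b = \<beta>\<close>,
  \<open>c = \<alpha>\<close>), its Hardy average (\<open>1\<close>, \<open>1\<close>) and their
  difference (\<open>1 - \<beta>\<close>, \<open>1 - \<alpha>\<close>).\<close>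

definition two_powers :: "real \<Rightarrow> real \<Rightarrow> real \<Rightarrow> real \<Rightarrow> real \<Rightarrow> real" where
  "two_powers \<alpha> \<beta> b c t =
    (if t \<le> 0 then 0 else if t \<le> 1 then b * t powr (\<beta> - 1) else c * t powr (\<alpha> - 1))"

lemma borel_measurable_two_powers: "two_powers \<alpha> \<beta> b c \<in> borel_measurable borel"
  unfolding two_powers_def[abs_def] by measurable

text \<open>The integrand has exponent \<open>p * (\<beta> - g) - 1\<close> up to 1 and
  \<open>- p * (g - \<alpha>) - 1\<close> beyond it; \<open>\<alpha> < g < \<beta>\<close> makes it
  integrable at both ends.\<close>

lemma two_powers_norm_has_integral:
  fixes p a g :: real
  assumes p: "1 \<le> p" and g: "g = (p - 1 - a) / p" and ab: "\<alpha> < g" "g < \<beta>"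
  shows "((\<lambda>t. \<bar>two_powers \<alpha> \<beta> b c t\<bar> powr p * t powr a) has_integral
    (\<bar>b\<bar> powr p / (p * (\<beta> - g)) + \<bar>c\<bar> powr p / (p * (g - \<alpha>)))) {0..}"
proof -
  let ?u = "\<lambda>t. \<bar>two_powers \<alpha> \<beta> b c t\<bar> powr p * t powr a"
  have pg: "p * g = p - 1 - a" using p g by simp
  have ex: "(\<beta> - 1) * p + a = p * (\<beta> - g) - 1" "(\<alpha> - 1) * p + a = - (p * (g - \<alpha>)) - 1"
    using pg by (simp_all add: algebra_simps)
  have pos: "p * (\<beta> - g) > 0" "p * (g - \<alpha>) > 0" using p ab by auto
  have pw: "\<bar>d * t powr (e - 1)\<bar> powr p * t powr a = \<bar>d\<bar> powr p * t powr ((e - 1) * p + a)"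
    for d e t :: real
    by (simp add: abs_mult powr_mult powr_powr powr_add)
  have "((\<lambda>t. \<bar>b\<bar> powr p * t powr (p * (\<beta> - g) - 1)) has_integral
      \<bar>b\<bar> powr p * (1 powr (p * (\<beta> - g) - 1 + 1) / (p * (\<beta> - g) - 1 + 1))) {0..1}"
    by (intro has_integral_mult_right has_integral_powr_from_0) (use pos in auto)
  moreover have "\<bar>b\<bar> powr p * t powr (p * (\<beta> - g) - 1) = ?u t" if "t \<in> {0..1}" for t
    using that unfolding two_powers_def ex(1)[symmetric] pw[symmetric] by auto
  ultimately have left: "(?u has_integral
      \<bar>b\<bar> powr p * (1 powr (p * (\<beta> - g) - 1 + 1) / (p * (\<beta> - g) - 1 + 1))) {0..1}"
    by (rule has_integral_eq[rotated])
  have right': "((\<lambda>t. \<bar>c\<bar> powr p * t powr (- (p * (g - \<alpha>)) - 1)) has_integral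
      \<bar>c\<bar> powr p * (- (1 powr (- (p * (g - \<alpha>)) - 1 + 1)) / (- (p * (g - \<alpha>)) - 1 + 1))) {1..}"
    by (intro has_integral_mult_right has_integral_powr_to_inf) (use pos in auto)
  have "?u t = \<bar>c\<bar> powr p * t powr (- (p * (g - \<alpha>)) - 1)" if "t \<in> {1..} - {1}" for t
    using that unfolding two_powers_def ex(2)[symmetric] pw[symmetric] by auto
  then have right: "(?u has_integral
      \<bar>c\<bar> powr p * (- (1 powr (- (p * (g - \<alpha>)) - 1 + 1)) / (- (p * (g - \<alpha>)) - 1 + 1))) {1..}"
    \<comment> \<open>At \<open>t = 1\<close> the definition takes the left branch, so the
      right-hand formula holds only off that point.\<close>
    by (rule has_integral_spike_finite[where S = "{1}", OF _ _ right', rotated]) simp_all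
  have "{0..1} \<inter> {1..} = {1::real}" "{0..1} \<union> {1..} = {0::real..}" by auto
  then have "(?u has_integral
      \<bar>b\<bar> powr p * (1 powr (p * (\<beta> - g) - 1 + 1) / (p * (\<beta> - g) - 1 + 1)) +
      \<bar>c\<bar> powr p * (- (1 powr (- (p * (g - \<alpha>)) - 1 + 1)) / (- (p * (g - \<alpha>)) - 1 + 1))) {0..}"
    using has_integral_Un[OF left right] by simp
  then show ?thesis using pos by simp
qed

lemma two_powers_nn_integral:
  fixes p a g :: real
  assumes "1 \<le> p" and "g = (p - 1 - a) / p" and "\<alpha> < g" "g < \<beta>"
  shows "(\<integral>\<^sup>+t\<in>{0<..}. ennreal (\<bar>two_powers \<alpha> \<beta> b c t\<bar> powr p * t powr a) \<partial>lebesgue)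
    = ennreal (\<bar>b\<bar> powr p / (p * (\<beta> - g)) + \<bar>c\<bar> powr p / (p * (g - \<alpha>)))"
proof -
  have "(\<integral>\<^sup>+t\<in>{0<..}. ennreal (\<bar>two_powers \<alpha> \<beta> b c t\<bar> powr p * t powr a) \<partial>lebesgue)
    = (\<integral>\<^sup>+t\<in>{0..}. ennreal (\<bar>two_powers \<alpha> \<beta> b c t\<bar> powr p * t powr a) \<partial>lebesgue)"
    by (intro nn_integral_cong) (auto simp: indicator_def two_powers_def)
  also have "\<dots> = ennreal (\<bar>b\<bar> powr p / (p * (\<beta> - g)) + \<bar>c\<bar> powr p / (p * (g - \<alpha>)))"
    unfolding nn_integral_completion
    by (rule nn_integral_has_integral_lebesgue'[OF _ two_powers_norm_has_integral[OF assms]]) auto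
  finally show ?thesis .
qed

lemma two_powers_has_integral:
  assumes \<beta>: "0 < \<beta>" and t: "0 < t"
  shows "(two_powers \<alpha> \<beta> \<beta> \<alpha> has_integral t * two_powers \<alpha> \<beta> 1 1 t) {0..t}"
proof -
  \<comment> \<open>The antiderivative: it is continuous at 0 because \<open>\<beta> > 0\<close>,
    and at 1 because both powers equal 1 there. Only at 1 can differentiability fail.\<close>
  define H where "H s = (if s \<le> 1 then s powr \<beta> else s powr \<alpha>)" for s :: real
  have "continuous_on ({0..1} \<union> {1..}) H"
    unfolding H_def
  proof (rule continuous_on_If)
    show "continuous_on {0..1::real} (\<lambda>s. s powr \<beta>)"
      by (intro continuous_on_powr' continuous_intros) (use \<beta> in auto)
    show "continuous_on {1::real..} (\<lambda>s. s powr \<alpha>)"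
      by (intro continuous_intros) auto
  qed auto
  then have cont: "continuous_on {0..t} H" by (rule continuous_on_subset) auto
  have der: "(H has_vector_derivative two_powers \<alpha> \<beta> \<beta> \<alpha> s) (at s)" if s: "s \<in> {0<..<t} - {1}" for s
  proof (cases "s < 1")
    case True
    have "((\<lambda>s. s powr \<beta>) has_vector_derivative two_powers \<alpha> \<beta> \<beta> \<alpha> s) (at s)"
      unfolding has_real_derivative_iff_has_vector_derivative[symmetric] two_powers_def
      using s True by (auto intro!: derivative_eq_intros)
    then show ?thesis
      by (rule has_vector_derivative_transform_within_open[where S = "{..<1}"])
        (use True in \<open>auto simp: H_def\<close>)
  next
    case False
    have "((\<lambda>s. s powr \<alpha>) has_vector_derivative two_powers \<alpha> \<beta> \<beta> \<alpha> s) (at s)"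
      unfolding has_real_derivative_iff_has_vector_derivative[symmetric] two_powers_def
      using s False by (auto intro!: derivative_eq_intros)
    then show ?thesis
      by (rule has_vector_derivative_transform_within_open[where S = "{1<..}"])
        (use s False in \<open>auto simp: H_def\<close>)
  qed
  have "(two_powers \<alpha> \<beta> \<beta> \<alpha> has_integral (H t - H 0)) {0..t}"
    by (rule fundamental_theorem_of_calculus_interior_strong[of "{1}"])
      (use cont der t in auto)
  moreover have "H t - H 0 = t * two_powers \<alpha> \<beta> 1 1 t"
    using t by (auto simp: H_def two_powers_def powr_mult_base)
  ultimately show ?thesis by simp
qed

text \<open>The inequality is tested on \<open>two_powers \<alpha> \<beta> \<beta> \<alpha>\<close>,
  for which both sides are explicit.\<close>

lemma kfun_le_of_hardy_minus_id_bound: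
  fixes p a :: real
  assumes p: "1 \<le> p" and a: "a < p - 1" and K: "hardy_minus_id_bound p a K"
    and ab: "\<alpha> < (p - 1 - a) / p" "(p - 1 - a) / p < \<beta>"
  shows "kfun p a \<alpha> \<beta> \<le> K powr p"
proof -
  define g where "g = (p - 1 - a) / p"
  let ?f = "two_powers \<alpha> \<beta> \<beta> \<alpha>"
  note ab = ab[folded g_def]
  have g: "0 < g" unfolding g_def using crit_pos[OF p a] .
  have meas: "?f \<in> borel_measurable lebesgue"
    by (intro measurable_completion) (simp add: borel_measurable_two_powers)
  interpret hardy_function p a g ?f
    by (rule hardy_function.intro[OF p a g_def meas _
          has_integral_integrable[OF two_powers_norm_has_integral[OF p g_def ab]]])
      (simp add: two_powers_def)
  define I where "I b c = \<bar>b\<bar> powr p / (p * (\<beta> - g)) + \<bar>c\<bar> powr p / (p * (g - \<alpha>))" for b c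
  have pos: "0 < p" "\<beta> - g > 0" "g - \<alpha> > 0" using p ab by auto
  \<comment> \<open>Multiplication by this common factor turns the two integrals into the numerator
    and the denominator of k.\<close>
  have I: "I b c * (p * (\<beta> - g) * (g - \<alpha>)) = (g - \<alpha>) * \<bar>b\<bar> powr p + (\<beta> - g) * \<bar>c\<bar> powr p" for b c
  proof -
    have "(X / (p * u) + Y / (p * v)) * (p * u * v) = v * X + u * Y" if "0 < u" "0 < v" for X Y u v
      using that pos(1) by (simp add: field_simps)
    then show ?thesis unfolding I_def using pos by simp
  qed
  have I0: "0 \<le> I b c" for b c unfolding I_def using pos by simp
  note nn = two_powers_nn_integral[OF p g_def ab, folded I_def]
  have diff: "hardy ?f t - ?f t = two_powers \<alpha> \<beta> (1 - \<beta>) (1 - \<alpha>) t" if "0 < t" for t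
  proof -
    have "F t = t * two_powers \<alpha> \<beta> 1 1 t"
      unfolding F_def using two_powers_has_integral[of \<beta> t \<alpha>] g ab that by (intro integral_unique) auto
    then show ?thesis using that unfolding hardy_eq[OF that] two_powers_def by (auto simp: algebra_simps)
  qed
  have "ennreal (I (1 - \<beta>) (1 - \<alpha>))
      = (\<integral>\<^sup>+t\<in>{0<..}. ennreal (\<bar>hardy ?f t - ?f t\<bar> powr p * t powr a) \<partial>lebesgue)"
    unfolding nn[symmetric] by (intro nn_integral_cong) (auto simp: indicator_def diff)
  also have "\<dots> \<le> ennreal (K powr p) * (\<integral>\<^sup>+t\<in>{0<..}. ennreal (\<bar>?f t\<bar> powr p * t powr a) \<partial>lebesgue)"
    using K measurable_restrict_space1[OF meas, of "{0..}"]
    unfolding hardy_minus_id_bound_def by (auto simp: nn)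
  also have "\<dots> = ennreal (K powr p * I \<beta> \<alpha>)" unfolding nn by (rule ennreal_mult'[symmetric]) simp
  finally have "I (1 - \<beta>) (1 - \<alpha>) \<le> K powr p * I \<beta> \<alpha>"
    using I0[of \<beta> \<alpha>] by (simp add: ennreal_le_iff)
  then have "I (1 - \<beta>) (1 - \<alpha>) * (p * (\<beta> - g) * (g - \<alpha>))
      \<le> (K powr p * I \<beta> \<alpha>) * (p * (\<beta> - g) * (g - \<alpha>))"
    using pos by (intro mult_right_mono) auto
  then have "(g - \<alpha>) * \<bar>1 - \<beta>\<bar> powr p + (\<beta> - g) * \<bar>1 - \<alpha>\<bar> powr p
      \<le> K powr p * ((g - \<alpha>) * \<bar>\<beta>\<bar> powr p + (\<beta> - g) * \<bar>\<alpha>\<bar> powr p)"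
    unfolding mult.assoc[of "K powr p"] I .
  then show ?thesis
    using ab unfolding g_def
    by (subst kfun_le_iff[OF p a]) (auto simp: abs_minus_commute add.commute)
qed

section \<open>The optimal constant\<close>

lemma hardy_minus_id_bound_iff:
  assumes p: "1 \<le> p" and a: "a < p - 1"
  shows "hardy_minus_id_bound p a K \<longleftrightarrow> 0 \<le> K \<and> Sup (kvalues p a) \<le> K powr p"
proof
  assume K: "hardy_minus_id_bound p a K"
  have "kvalues p a \<noteq> {}"
    using kvaluesI[OF p a, of "(p - 1 - a) / p - 1" "(p - 1 - a) / p + 1"] by auto
  then have "Sup (kvalues p a) \<le> K powr p"
    by (rule cSup_least)
      (use kfun_le_of_hardy_minus_id_bound[OF p a K] in \<open>auto simp: kvalues_def\<close>)
  then show "0 \<le> K \<and> Sup (kvalues p a) \<le> K powr p"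
    using K by (simp add: hardy_minus_id_bound_def)
qed (use hardy_minus_id_bound_of_Sup_le[OF assms] in auto)

theorem theorem2p1:
  fixes p a :: real
  assumes "1 \<le> p" and "a < p - 1"
  shows "hardy_minus_id_bound p a (hardy_const p a)
    \<and> (\<forall>K. hardy_minus_id_bound p a K \<longrightarrow> hardy_const p a \<le> K)
    \<and> bdd_above (kvalues p a)
    \<and> hardy_const p a powr p = Sup (kvalues p a)"
proof -
  define S where "S = Sup (kvalues p a)"
  note iff = hardy_minus_id_bound_iff[OF assms, folded S_def]
  have S: "1 \<le> S" unfolding S_def by (rule one_le_Sup_kvalues[OF assms])
  have pow: "(S powr (1 / p)) powr p = S" using S assms by (simp add: powr_powr)
  have bound: "hardy_minus_id_bound p a (S powr (1 / p))"
    unfolding iff pow by simp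
  have least: "S powr (1 / p) \<le> K" if "hardy_minus_id_bound p a K" for K
  proof -
    have K: "0 \<le> K" "S \<le> K powr p" using that unfolding iff by auto
    have "S powr (1 / p) \<le> (K powr p) powr (1 / p)"
      by (rule powr_mono2) (use K S assms in auto)
    also have "\<dots> = K" using K assms by (simp add: powr_powr)
    finally show ?thesis .
  qed
  \<comment> \<open>On the reals \<open>LEAST\<close> has a determined value only once a minimum is
    exhibited; \<open>S powr (1 / p)\<close> is that minimum.\<close>
  have const: "hardy_const p a = S powr (1 / p)"
    unfolding hardy_const_def by (rule Least_equality) (use bound least in auto)
  show ?thesis
    unfolding const pow using bound least bdd_above_kvalues[OF assms] by (auto simp: S_def)
qed

end
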